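(* Let $X\subset\mathbb{CP}^4$ be a quintic 3-fold with small $J$-function $J(Q,q,0)\in K(X)\otimes\mathbb Q(q)[[Q]]$, and let $\mathrm{GV}_d$ $(d\ge 1)$ be its genus 0 Gopakumar--Vafa invariants. Assume that $$\frac{1}{1-q}J(Q,q,0)=1+x^2\sum_{d,r\ge1}a(d,r,q^r)\,\mathrm{GV}_d\,Q^{dr}+x^3\sum_{d,r\ge1}b(d,r,q^r)\,\mathrm{GV}_d\,Q^{dr}.$$ Then $$5J(Q,0,0)=5+x^2\sum_{n=1}^\infty n\,\mathrm{GV}^{(0)}_n Q^n+x^3\sum_{n=1}^\infty\big(n\,\mathrm{GV}^{(0)}_n+n^2\,\mathrm{GV}^{(-2)}_n\big)Q^n$$ $$=5+\big(2875Q+1224250Q^2+951627750Q^3+969872568500Q^4+\cdots\big)x^2+\big(5750Q+1845000Q^2+1268860000Q^3+1212342581500Q^4+\cdots\big)x^3 .$$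
   Context: $K(X)=\mathbb Q[x]/(x^4)$ is the rational K-theory ring of the quintic (the part generated by line bundles restricted from $\mathbb{CP}^4$), where $1-x$ is the class of $\mathcal O(-1)|_X$; it has basis $\Phi_\alpha=x^\alpha$, $\alpha=0,1,2,3$, and nondegenerate pairing $(E,F)\mapsto\chi(E\otimes F)$ (holomorphic Euler characteristic); $\{\Phi^\alpha\}$ is the dual basis. For $d\ge1$, $\langle \Phi L^{k}\rangle_{0,1,d}$ is the genus 0 K-theoretic Gromov--Witten invariant, i.e. the holomorphic Euler characteristic of $\mathcal O^{\rm vir}\otimes {\rm ev}_1^*(\Phi)\otimes L_1^{k}$ over the moduli space of genus 0, degree $d$ stable maps to $X$ with one marked point, where $L_1$ is the cotangent line (orbi)bundle at the marked point; $\langle\frac{\Phi}{1-qL}\rangle_{0,1,d}$ is the generating series $\sum_{k\ge 0} q^k\langle\Phi L^k\rangle_{0,1,d}$, which is a rational function of $q$, regular at $q=0$. The small $J$-function is $$J(Q,q,0)=(1-q)\Phi_0+\sum_{d\ge1}\sum_{\alpha=0}^3\Big\langle\frac{\Phi_\alpha}{1-qL}\Big\rangle_{0,1,d}\Phi^\alpha Q^d .$$ $J(Q,0,0)$ denotes its value at $q=0$. The functions $a,b$ are defined by $$5a(d,r,q)=\frac{dr}{1-q}+\frac{dq}{(1-q)^2},\qquad 5b(d,r,q)=\frac{rd+r^2-d}{1-q}+\frac{d}{(1-q)^2}-\frac{q+q^2}{(1-q)^3}.$$ The Gopakumar--Vafa invariants are $\mathrm{GV}_n=\sum_{d|n}\frac{\mu(d)}{d^3}\mathrm{GW}_{n/d}$,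 with $\mathrm{GW}_n$ the genus 0 degree $n$ Gromov--Witten invariants of the quintic. The first values are $\mathrm{GV}_1=2875$, $\mathrm{GV}_2=609250$, $\mathrm{GV}_3=317206375$, $\mathrm{GV}_4=242467530000$. For an integer $\gamma$, $\mathrm{GV}^{(\gamma)}_n=\sum_{d|n}d^\gamma\,\mathrm{GV}_d$. *)

theory Defs
  imports
    "HOL-Computational_Algebra.Computational_Algebra"
    "HOL-Computational_Algebra.Field_as_Ring"
    "HOL-Analysis.Infinite_Sum"
begin

section \<open>The truncated polynomial ring \<open>R[x]/(x^4)\<close>\<close>

definition trunc_rel :: "'a::comm_ring_1 poly \<Rightarrow> 'a poly \<Rightarrow> bool" where
  "trunc_rel p q \<longleftrightarrow> [:0, 1:] ^ 4 dvd p - q"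

lemma trunc_rel_iff: "trunc_rel p q \<longleftrightarrow> (\<forall>i<4. coeff p i = coeff q i)"
proof -
  have "[:0, 1:] ^ 4 = (monom 1 4 :: 'a poly)"
    by (simp add: monom_altdef)
  thus ?thesis
    by (simp add: trunc_rel_def monom_1_dvd_iff')
qed

text \<open>
  For a commutative ring \<open>R\<close>, \<open>R quintic_K\<close> is \<open>K(X) \<otimes> R\<close> with \<open>K(X) = \<rat>[x]/(x^4)\<close>.
  So \<open>rat quintic_K\<close> is \<open>K(X)\<close> itself, and \<open>rat poly fract quintic_K fps\<close> is
  \<open>K(X) \<otimes> \<rat>(q)[[Q]]\<close>.
\<close>

quotient_type (overloaded) 'a quintic_K = "'a::comm_ring_1 poly" / trunc_rel
  by (rule equivpI) (auto simp: reflp_def symp_def transp_def trunc_rel_iff)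

instantiation quintic_K :: (comm_ring_1) comm_ring_1
begin

lift_definition zero_quintic_K :: "'a quintic_K" is 0 .
lift_definition one_quintic_K :: "'a quintic_K" is 1 .
lift_definition plus_quintic_K :: "'a quintic_K \<Rightarrow> 'a quintic_K \<Rightarrow> 'a quintic_K" is "(+)"
  by (simp add: trunc_rel_iff)
lift_definition minus_quintic_K :: "'a quintic_K \<Rightarrow> 'a quintic_K \<Rightarrow> 'a quintic_K" is "(-)"
  by (simp add: trunc_rel_iff)
lift_definition uminus_quintic_K :: "'a quintic_K \<Rightarrow> 'a quintic_K" is uminus
  by (simp add: trunc_rel_iff)
lift_definition times_quintic_K :: "'a quintic_K \<Rightarrow> 'a quintic_K \<Rightarrow> 'a quintic_K" is "(*)"
  by (simp add: trunc_rel_iff coeff_mult)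

instance
proof
  show "(0::'a quintic_K) \<noteq> 1"
    by transfer (auto simp: trunc_rel_iff intro!: exI[of _ 0])
qed (transfer; simp add: trunc_rel_iff algebra_simps)+

end

lift_definition K_scalar :: "'a::comm_ring_1 \<Rightarrow> 'a quintic_K" is "\<lambda>c. [:c:]" .

lift_definition K_x :: "'a::comm_ring_1 quintic_K" is "[:0, 1:]" .

lift_definition K_coeff :: "'a::comm_ring_1 quintic_K \<Rightarrow> nat \<Rightarrow> 'a" is
  "\<lambda>p i. if i < 4 then coeff p i else 0"
  by (auto simp: trunc_rel_iff)

text \<open>The map \<open>id \<otimes> f\<close> from \<open>K(X) \<otimes> R\<close> to \<open>K(X) \<otimes> S\<close>, in the basis \<open>1, x, x^2, x^3\<close>.\<close>

definition K_map :: "('a::comm_ring_1 \<Rightarrow> 'b::comm_ring_1) \<Rightarrow> 'a quintic_K \<Rightarrow> 'b quintic_K" where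
  "K_map f E = (\<Sum>i<4. K_scalar (f (K_coeff E i)) * K_x ^ i)"

lemma K_eqI: "(\<And>i. i < 4 \<Longrightarrow> K_coeff E i = K_coeff F i) \<Longrightarrow> E = F"
  by transfer (force simp: trunc_rel_iff)

lemma K_coeff_0 [simp]: "K_coeff 0 i = 0"
  by transfer simp

lemma K_coeff_add [simp]: "K_coeff (E + F) i = K_coeff E i + K_coeff F i"
  by transfer simp

lemma K_coeff_sum: "K_coeff (\<Sum>a\<in>A. g a) i = (\<Sum>a\<in>A. K_coeff (g a) i)"
  by (induction A rule: infinite_finite_induct) auto

lemma K_coeff_scalar: "K_coeff (K_scalar c) i = (if i = 0 then c else 0)"
  by transfer (auto simp: coeff_pCons split: nat.splits)

lemma K_coeff_scalar_mult [simp]: "K_coeff (K_scalar c * E) i = c * K_coeff E i"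
  by transfer simp

lemma abs_quintic_K_power: "abs_quintic_K p ^ n = abs_quintic_K (p ^ n)"
  by (induction n) (simp_all add: one_quintic_K_def times_quintic_K.abs_eq)

lemma K_x_power: "K_x ^ n = abs_quintic_K (monom 1 n)"
  by (simp add: K_x_def abs_quintic_K_power monom_altdef)

lemma K_coeff_x_power_mult:
  "K_coeff (K_x ^ n * E) i = (if n \<le> i \<and> i < 4 then K_coeff E (i - n) else 0)"
  unfolding K_x_power
  by (induction E rule: quintic_K.abs_induct) (auto simp: times_quintic_K.abs_eq K_coeff.abs_eq coeff_monom_mult)

lemma K_coeff_x_power: "K_coeff (K_x ^ n) i = (if i = n \<and> i < 4 then 1 else 0)"
  by (simp add: K_x_power K_coeff.abs_eq)

lemma K_coeff_map: "K_coeff (K_map f E) i = (if i < 4 then f (K_coeff E i) else 0)"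
proof -
  have "K_coeff (K_map f E) i = (\<Sum>j<4. if i = j \<and> i < 4 then f (K_coeff E j) else 0)"
    unfolding K_map_def K_coeff_sum by (intro sum.cong) (auto simp: K_coeff_x_power)
  also have "\<dots> = (if i < 4 then f (K_coeff E i) else 0)"
    by (auto simp: sum.delta)
  finally show ?thesis .
qed


section \<open>The pairing on \<open>K(X)\<close>\<close>

text \<open>
  \<open>\<chi>(X, O(n))\<close> for \<open>X\<close> a quintic in \<open>\<complex>\<pp>^4\<close>, from \<open>0 \<rightarrow> O(n - 5) \<rightarrow> O(n) \<rightarrow> O(n)|\<^sub>X \<rightarrow> 0\<close>
  and \<open>\<chi>(\<complex>\<pp>^4, O(m)) = (m + 4 choose 4)\<close> for every integer \<open>m\<close>.
\<close>

definition chi_line :: "int \<Rightarrow> rat" where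
  "chi_line n = ((of_int n + 4) gchoose 4) - ((of_int n - 1) gchoose 4)"

text \<open>
  The holomorphic Euler characteristic, extended linearly from
  \<open>x^i = (1 - O(-1))^i = (\<Sum>j\<le>i. (-1)^j (i choose j) O(-j))\<close>.
\<close>

definition chi_X :: "rat quintic_K \<Rightarrow> rat" where
  "chi_X E = (\<Sum>i<4. K_coeff E i *
     (\<Sum>j\<le>i. (-1) ^ j * of_nat (i choose j) * chi_line (- int j)))"

definition K_pairing :: "rat quintic_K \<Rightarrow> rat quintic_K \<Rightarrow> rat" where
  "K_pairing E F = chi_X (E * F)"

definition K_dual_basis :: "nat \<Rightarrow> rat quintic_K" where
  "K_dual_basis \<alpha> =
     (THE \<Psi>. \<forall>\<beta><4. K_pairing (K_x ^ \<beta>) \<Psi> = (if \<beta> = \<alpha> then 1 else 0))"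

lemma chi_X_eq: "chi_X E = 5 * K_coeff E 1 - 5 * K_coeff E 2 + 5 * K_coeff E 3"
  by (simp add: chi_X_def chi_line_def eval_nat_numeral gbinomial_prod_rev atLeast0_lessThan_Suc
        lessThan_Suc atMost_Suc)

lemma K_coeff_one_minus_x_power:
  "K_coeff ((1 - K_x) ^ n) i = (if i < 4 then (-1) ^ i * of_nat (n choose i) else 0)"
proof -
  have "(1 - K_x) ^ n = abs_quintic_K ([:1, -1:] ^ n :: 'a poly)"
    by (simp add: K_x_def one_quintic_K_def minus_quintic_K.abs_eq abs_quintic_K_power one_pCons)
  moreover have "coeff ([:1, -1:] ^ n :: 'a poly) i = (-1) ^ i * of_nat (n choose i)"
  proof (cases "i \<le> n")
    case True
    thus ?thesis by (simp add: coeff_linear_poly_power mult.commute)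
  next
    case False
    have "degree ([:1, -1:] ^ n :: 'a poly) \<le> degree [:1, -1 :: 'a:] * n"
      by (rule degree_power_le)
    also have "\<dots> \<le> 1 * n"
      by (rule mult_right_mono) auto
    finally have "degree ([:1, -1:] ^ n :: 'a poly) < i"
      using False by simp
    thus ?thesis
      using False by (simp add: coeff_eq_0 binomial_eq_0)
  qed
  ultimately show ?thesis
    by (simp add: K_coeff.abs_eq)
qed

lemma gchoose_small:
  fixes a :: rat
  shows "a gchoose 2 = a * (a - 1) / 2"
    and "a gchoose 3 = a * (a - 1) * (a - 2) / 6"
    and "a gchoose 4 = a * (a - 1) * (a - 2) * (a - 3) / 24"
proof -
  have "{0..<2::nat} = {0, 1}" "{0..<3::nat} = {0, 1, 2}" "{0..<4::nat} = {0, 1, 2, 3}"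
    by auto
  thus "a gchoose 2 = a * (a - 1) / 2"
    and "a gchoose 3 = a * (a - 1) * (a - 2) / 6"
    and "a gchoose 4 = a * (a - 1) * (a - 2) * (a - 3) / 24"
    by (simp_all add: gbinomial_prod_rev fact_numeral)
qed

lemma chi_X_line_bundle: "chi_X ((1 - K_x) ^ n) = chi_line (- int n)"
proof -
  define t where "t = (of_nat n :: rat)"
  have 1: "of_nat (n choose 1) = t" "of_nat (n choose 2) = t * (t - 1) / 2"
    "of_nat (n choose 3) = t * (t - 1) * (t - 2) / 6"
    by (simp_all only: binomial_gbinomial t_def gbinomial_1 gchoose_small)
  have 2: "of_int (- int n) = - t"
    by (simp add: t_def)
  have "chi_X ((1 - K_x) ^ n) = - 5 * t - 5 * (t * (t - 1) / 2) - 5 * (t * (t - 1) * (t - 2) / 6)"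
    unfolding chi_X_eq K_coeff_one_minus_x_power 1 by simp
  also have "\<dots> = chi_line (- int n)"
    unfolding chi_line_def gchoose_small 2 by (simp add: field_simps)
  finally show ?thesis .
qed

lemma K_pairing_x_power:
  assumes "\<beta> < 4"
  shows "K_pairing (K_x ^ \<beta>) E =
    (if \<beta> = 0 then 5 * K_coeff E 1 - 5 * K_coeff E 2 + 5 * K_coeff E 3
     else if \<beta> = 1 then 5 * K_coeff E 0 - 5 * K_coeff E 1 + 5 * K_coeff E 2
     else if \<beta> = 2 then - 5 * K_coeff E 0 + 5 * K_coeff E 1
     else 5 * K_coeff E 0)"
proof -
  have "\<beta> = 0 \<or> \<beta> = 1 \<or> \<beta> = 2 \<or> \<beta> = 3"
    using assms by auto
  thus ?thesis
    unfolding K_pairing_def chi_X_eq K_coeff_x_power_mult by (elim disjE) simp_all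
qed

lemma ex1_dual_basis:
  "\<exists>!\<Psi>. \<forall>\<beta><4. K_pairing (K_x ^ \<beta>) \<Psi> = (if \<beta> = \<alpha> then 1 else 0)"
proof -
  define \<delta> :: "nat \<Rightarrow> rat" where "\<delta> = (\<lambda>\<beta>. if \<beta> = \<alpha> then 1 else 0)"
  define c where "c = (\<lambda>i::nat. if i = 0 then \<delta> 3 / 5 else if i = 1 then (\<delta> 2 + \<delta> 3) / 5
     else if i = 2 then (\<delta> 1 + \<delta> 2) / 5 else (\<delta> 0 + \<delta> 1 - \<delta> 3) / 5)"
  define P where "P = (\<lambda>\<Psi>. \<forall>\<beta><4. K_pairing (K_x ^ \<beta>) \<Psi> = \<delta> \<beta>)"
  define \<Psi>0 where "\<Psi>0 = (\<Sum>i<4. K_scalar (c i) * K_x ^ i)"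
  have all4: "(\<forall>\<beta><4. R \<beta>) \<longleftrightarrow> R 0 \<and> R 1 \<and> R 2 \<and> R (3::nat)" for R
    by (simp add: numeral_eq_Suc all_simps less_Suc_eq) blast
  have \<Psi>0: "K_coeff \<Psi>0 i = c i" if "i < 4" for i
  proof -
    have "K_coeff \<Psi>0 i = (\<Sum>j<4. if i = j then c j else 0)"
      unfolding \<Psi>0_def K_coeff_sum using that
      by (intro sum.cong) (auto simp: K_coeff_x_power)
    thus ?thesis using that by simp
  qed
  have pairing:
    "K_pairing (K_x ^ 0) E = 5 * K_coeff E 1 - 5 * K_coeff E 2 + 5 * K_coeff E 3"
    "K_pairing (K_x ^ 1) E = 5 * K_coeff E 0 - 5 * K_coeff E 1 + 5 * K_coeff E 2"
    "K_pairing (K_x ^ 2) E = - 5 * K_coeff E 0 + 5 * K_coeff E 1"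
    "K_pairing (K_x ^ 3) E = 5 * K_coeff E 0" for E
    by (subst K_pairing_x_power; simp)+
  have c: "c 0 = \<delta> 3 / 5" "c 1 = (\<delta> 2 + \<delta> 3) / 5" "c 2 = (\<delta> 1 + \<delta> 2) / 5"
    "c 3 = (\<delta> 0 + \<delta> 1 - \<delta> 3) / 5"
    by (simp_all add: c_def)
  have iff: "P \<Psi> \<longleftrightarrow> (\<forall>i<4. K_coeff \<Psi> i = c i)" for \<Psi>
    unfolding P_def all4 pairing c by (auto simp: field_simps)
  have "\<exists>!\<Psi>. P \<Psi>"
    unfolding iff by (rule ex1I[of _ \<Psi>0]) (auto simp: \<Psi>0 intro: K_eqI)
  thus ?thesis
    unfolding P_def \<delta>_def .
qed


section \<open>Rational functions in \<open>q\<close>\<close>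

type_synonym ratfun = "rat poly fract"

definition rf_const :: "rat \<Rightarrow> ratfun" where
  "rf_const c = to_fract [:c:]"

definition rf_q :: ratfun where
  "rf_q = to_fract [:0, 1:]"

text \<open>
  \<^const>\<open>quot_of_fract\<close> yields numerator and denominator in lowest terms, so regularity
  at a point means that the denominator does not vanish there.
\<close>

definition rf_regular_at :: "rat \<Rightarrow> ratfun \<Rightarrow> bool" where
  "rf_regular_at c f \<longleftrightarrow> poly (snd (quot_of_fract f)) c \<noteq> 0"

definition rf_eval :: "rat \<Rightarrow> ratfun \<Rightarrow> rat" where
  "rf_eval c f = poly (fst (quot_of_fract f)) c / poly (snd (quot_of_fract f)) c"

text \<open>The Taylor expansion at \<open>q = 0\<close>; meaningful only for \<open>f\<close> regular there.\<close>

definition rf_taylor :: "ratfun \<Rightarrow> rat fps" where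
  "rf_taylor f = fps_of_poly (fst (quot_of_fract f)) / fps_of_poly (snd (quot_of_fract f))"

definition represents_series :: "ratfun \<Rightarrow> rat fps \<Rightarrow> bool" where
  "represents_series f F \<longleftrightarrow> rf_regular_at 0 f \<and> rf_taylor f = F"

lemma represents_series_unique:
  assumes "represents_series f F" "represents_series g F"
  shows "f = g"
proof -
  define a b c d where "a = fst (quot_of_fract f)" and "b = snd (quot_of_fract f)"
    and "c = fst (quot_of_fract g)" and "d = snd (quot_of_fract g)"
  have nz: "fps_nth (fps_of_poly b) 0 \<noteq> 0" "fps_nth (fps_of_poly d) 0 \<noteq> 0"
    using assms by (auto simp: represents_series_def rf_regular_at_def b_def d_def poly_0_coeff_0)
  have "fps_of_poly a / fps_of_poly b = fps_of_poly c / fps_of_poly d"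
    using assms by (simp add: represents_series_def rf_taylor_def a_def b_def c_def d_def)
  hence "fps_of_poly a * inverse (fps_of_poly b) = fps_of_poly c * inverse (fps_of_poly d)"
    using nz by (simp add: fps_divide_unit)
  moreover have "inverse (fps_of_poly b) * fps_of_poly b = 1"
    and "inverse (fps_of_poly d) * fps_of_poly d = 1"
    using nz by (simp_all only: inverse_mult_eq_1 not_False_eq_True)
  ultimately have "fps_of_poly a * fps_of_poly d = fps_of_poly c * fps_of_poly b"
    by algebra
  hence "fps_of_poly (a * d) = fps_of_poly (c * b)"
    by (simp only: fps_of_poly_mult)
  hence "a * d = c * b"
    by (simp add: fps_of_poly_eq_iff)
  moreover have "b \<noteq> 0" "d \<noteq> 0"
    by (simp_all add: b_def d_def)
  ultimately have "Fract a b = Fract c d"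
    by (simp add: eq_fract)
  thus ?thesis
    by (simp add: a_def b_def c_def d_def)
qed


section \<open>K-theoretic invariants and the small \<open>J\<close>-function\<close>

text \<open>
  The moduli stacks \<open>M\<^sub>d\<close> of degree \<open>d\<close>, genus 0 stable maps to \<open>X\<close> with one marked point
  enter through the data of which the invariants are built:

  \<^item> \<open>'m\<close> is the rational K-ring of orbifold vector bundles on the disjoint union of the \<open>M\<^sub>d\<close>,
    that is, the product of the K-rings of the \<open>M\<^sub>d\<close>;
  \<^item> \<open>ev\<close> is the pullback along the evaluation map at the marked point;
  \<^item> \<open>L\<close> is the class of the cotangent line bundle at the marked point;
  \<^item> \<open>chi_vir d E\<close> is the holomorphic Euler characteristic on \<open>M\<^sub>d\<close> of \<open>O\<^sup>v\<^sup>i\<^sup>r \<otimes> E\<close>.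
\<close>

definition K_invariant ::
    "(rat quintic_K \<Rightarrow> 'm::comm_ring_1) \<Rightarrow> 'm \<Rightarrow> (nat \<Rightarrow> 'm \<Rightarrow> rat) \<Rightarrow> nat \<Rightarrow> rat quintic_K \<Rightarrow> nat \<Rightarrow> rat"
  where "K_invariant ev L chi_vir d \<Phi> k = chi_vir d (ev \<Phi> * L ^ k)"

definition K_invariant_series ::
    "(rat quintic_K \<Rightarrow> 'm::comm_ring_1) \<Rightarrow> 'm \<Rightarrow> (nat \<Rightarrow> 'm \<Rightarrow> rat) \<Rightarrow> nat \<Rightarrow> rat quintic_K \<Rightarrow> rat fps"
  where "K_invariant_series ev L chi_vir d \<Phi> = Abs_fps (K_invariant ev L chi_vir d \<Phi>)"

locale stable_maps_K_theory =
  fixes ev :: "rat quintic_K \<Rightarrow> 'm::comm_ring_1"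
    and L :: 'm
    and chi_vir :: "nat \<Rightarrow> 'm \<Rightarrow> rat"
  assumes ev_one: "ev 1 = 1"
    and ev_add: "ev (E + F) = ev E + ev F"
    and ev_mult: "ev (E * F) = ev E * ev F"
    and chi_vir_add: "d \<ge> 1 \<Longrightarrow> chi_vir d (A + B) = chi_vir d A + chi_vir d B"
    and rational: "d \<ge> 1 \<Longrightarrow> \<exists>f. represents_series f (K_invariant_series ev L chi_vir d \<Phi>)"

text \<open>\<open>\<langle>\<Phi> / (1 - q L)\<rangle>\<^sub>0\<^sub>,\<^sub>1\<^sub>,\<^sub>d\<close> as an element of \<open>\<rat>(q)\<close>.\<close>

definition K_correlator ::
    "(rat quintic_K \<Rightarrow> 'm::comm_ring_1) \<Rightarrow> 'm \<Rightarrow> (nat \<Rightarrow> 'm \<Rightarrow> rat) \<Rightarrow> nat \<Rightarrow> rat quintic_K \<Rightarrow> ratfun"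
  where "K_correlator ev L chi_vir d \<Phi> =
    (THE f. represents_series f (K_invariant_series ev L chi_vir d \<Phi>))"

definition small_J ::
    "(rat quintic_K \<Rightarrow> 'm::comm_ring_1) \<Rightarrow> 'm \<Rightarrow> (nat \<Rightarrow> 'm \<Rightarrow> rat) \<Rightarrow> ratfun quintic_K fps"
  where "small_J ev L chi_vir = Abs_fps (\<lambda>d.
    if d = 0 then K_scalar (1 - rf_q)
    else \<Sum>\<alpha><4. K_scalar (K_correlator ev L chi_vir d (K_x ^ \<alpha>)) * K_map rf_const (K_dual_basis \<alpha>))"

text \<open>The value \<open>J(Q,0,0)\<close>, taken in each coordinate of each coefficient.\<close>

definition small_J_at_0 ::
    "(rat quintic_K \<Rightarrow> 'm::comm_ring_1) \<Rightarrow> 'm \<Rightarrow> (nat \<Rightarrow> 'm \<Rightarrow> rat) \<Rightarrow> rat quintic_K fps"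
  where "small_J_at_0 ev L chi_vir =
    Abs_fps (\<lambda>d. K_map (rf_eval 0) (fps_nth (small_J ev L chi_vir) d))"


section \<open>Gopakumar--Vafa invariants\<close>

definition moebius :: "nat \<Rightarrow> rat" where
  "moebius n = (if squarefree n then (-1) ^ card (prime_factors n) else 0)"

text \<open>\<open>GW n\<close> stands for the genus 0, degree \<open>n\<close> Gromov--Witten invariant of \<open>X\<close>.\<close>

definition GV :: "(nat \<Rightarrow> rat) \<Rightarrow> nat \<Rightarrow> rat" where
  "GV GW n = (\<Sum>d | d dvd n. moebius d / of_nat d ^ 3 * GW (n div d))"

definition GV_twisted :: "(nat \<Rightarrow> rat) \<Rightarrow> int \<Rightarrow> nat \<Rightarrow> rat" where
  "GV_twisted GW \<gamma> n = (\<Sum>d | d dvd n. of_nat d powi \<gamma> * GV GW d)"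


section \<open>Formal series\<close>

definition fun_a :: "nat \<Rightarrow> nat \<Rightarrow> ratfun \<Rightarrow> ratfun" where
  "fun_a d r z = (of_nat d * of_nat r / (1 - z) + of_nat d * z / (1 - z)^2) / 5"

definition fun_b :: "nat \<Rightarrow> nat \<Rightarrow> ratfun \<Rightarrow> ratfun" where
  "fun_b d r z =
     ((of_nat r * of_nat d + of_nat r ^ 2 - of_nat d) / (1 - z)
      + of_nat d / (1 - z)^2 - (z + z^2) / (1 - z)^3) / 5"

text \<open>The formal sum of \<open>c d r Q^(d r)\<close> over all \<open>d, r \<ge> 1\<close>.\<close>

definition double_series :: "(nat \<Rightarrow> nat \<Rightarrow> 'a) \<Rightarrow> 'a::comm_ring_1 fps" where
  "double_series c = Abs_fps (\<lambda>n. \<Sum>(d, r) | d \<ge> 1 \<and> r \<ge> 1 \<and> d * r = n. c d r)"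

lemma double_series_has_sum:
  "((\<lambda>(d, r). fps_const (c d r) * fps_X ^ (d * r)) has_sum double_series c) ({1..} \<times> {1..})"
proof -
  let ?f = "\<lambda>(d, r). fps_const (c d r) * fps_X ^ (d * r)"
  have fin: "finite {(d, r). d \<ge> 1 \<and> r \<ge> 1 \<and> d * r = n}" for n :: nat
  proof (rule finite_subset)
    show "{(d, r). d \<ge> 1 \<and> r \<ge> 1 \<and> d * r = n} \<subseteq> {..n} \<times> {..n}"
      by auto
  qed auto
  show ?thesis
    unfolding has_sum_def tendsto_iff
  proof (intro allI impI)
    fix e :: real assume "e > 0"
    then obtain N :: nat where "(1 / 2) ^ N < e"
      using real_arch_pow_inv[of e "1 / 2"] by auto
    hence N: "inverse (2 ^ N) < e"
      by (simp add: power_one_over inverse_eq_divide)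
    define B where "B = (\<Union>n\<le>N. {(d, r). d \<ge> 1 \<and> r \<ge> 1 \<and> d * r = n})"
    have B: "finite B" "B \<subseteq> {1..} \<times> {1..}"
      using fin by (auto simp: B_def)
    show "\<forall>\<^sub>F S in finite_subsets_at_top ({1..} \<times> {1..}). dist (sum ?f S) (double_series c) < e"
      unfolding eventually_finite_subsets_at_top
    proof (intro exI[of _ B] conjI allI impI B)
      fix S assume S: "finite S \<and> B \<subseteq> S \<and> S \<subseteq> {1..} \<times> {1::nat..}"
      have nth: "fps_nth (sum ?f S) n = fps_nth (double_series c) n" if "n \<le> N" for n
      proof -
        have "fps_nth (sum ?f S) n = (\<Sum>(d, r)\<in>S. if d * r = n then c d r else 0)"
          unfolding fps_sum_nth by (intro sum.cong) auto
        also have "\<dots> = (\<Sum>(d, r) | d \<ge> 1 \<and> r \<ge> 1 \<and> d * r = n. c d r)"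
        proof (rule sum.mono_neutral_cong_right)
          show "finite S" using S by simp
          have "{(d, r). d \<ge> 1 \<and> r \<ge> 1 \<and> d * r = n} \<subseteq> B"
            using that by (auto simp: B_def)
          thus "{(d, r). d \<ge> 1 \<and> r \<ge> 1 \<and> d * r = n} \<subseteq> S"
            using S by blast
          show "\<forall>p\<in>S - {(d, r). d \<ge> 1 \<and> r \<ge> 1 \<and> d * r = n}.
              (case p of (d, r) \<Rightarrow> if d * r = n then c d r else 0) = 0"
            using S by (auto split: if_splits)
        qed auto
        finally show ?thesis
          by (simp add: double_series_def)
      qed
      show "dist (sum ?f S) (double_series c) < e"
      proof (cases "sum ?f S = double_series c")
        case False
        have "N \<le> subdegree (sum ?f S - double_series c)"
          using nth False by (intro subdegree_geI) auto
        hence "inverse (2 ^ subdegree (sum ?f S - double_series c)) \<le> (inverse (2 ^ N) :: real)"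
          by (intro le_imp_inverse_le power_increasing) auto
        moreover have "dist (sum ?f S) (double_series c) =
            inverse (2 ^ subdegree (sum ?f S - double_series c))"
          using False by (simp add: dist_fps_def)
        ultimately show ?thesis
          using N by linarith
      qed (use \<open>e > 0\<close> in auto)
    qed
  qed
qed

text \<open>The inclusion of \<open>R[[Q]]\<close> into \<open>(K(X) \<otimes> R)[[Q]]\<close>.\<close>

definition K_series :: "'a::comm_ring_1 fps \<Rightarrow> 'a quintic_K fps" where
  "K_series F = Abs_fps (\<lambda>n. K_scalar (fps_nth F n))"

end

theory Submission
  imports Defs
begin

text \<open>
  Multiplying the assumed formula by \<open>1 - q\<close> expresses the coefficients of \<open>J(Q,q,0)\<close> through
  \<open>a(d,r,q^r)\<close> and \<open>b(d,r,q^r)\<close> (\<open>K_coeff_of_normalized_series\<close>). All of these are regular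
  at \<open>q = 0\<close>, and evaluation at a point is a ring homomorphism on the rational functions regular
  there (\<open>rf_has_value_Fract\<close> and its consequences), so the value at \<open>q = 0\<close> may be computed
  summand by summand; the factor \<open>1 - q\<close> contributes \<open>1\<close>. As \<open>r \<ge> 1\<close>, the argument \<open>q^r\<close>
  vanishes at \<open>q = 0\<close> as well, and all that is left is \<open>5 a(d,r,0) = d r\<close> and
  \<open>5 b(d,r,0) = (r d + r^2 - d) + d = r d + r^2\<close>.

  For \<open>n \<ge> 1\<close> the pairs \<open>(d, r)\<close> with \<open>d r = n\<close> correspond to the divisors \<open>d\<close> of \<open>n\<close>, and
  \<open>r^2 = n^2 d^(-2)\<close>. So the terms \<open>d r\<close> add up to \<open>n GV^(0)_n\<close> and the terms \<open>r^2\<close> to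
  \<open>n^2 GV^(-2)_n\<close> (\<open>double_series_a_value_at_0\<close>, \<open>double_series_b_value_at_0\<close>). The numerical
  coefficients follow by listing the divisors of \<open>1, ..., 4\<close>.
\<close>

section \<open>Values of rational functions at a regular point\<close>

text \<open>
  \<^const>\<open>rf_eval\<close> is additive and multiplicative only away from poles. Carrying
  regularity along with the value gives a relation that is closed under the field operations.
\<close>

definition rf_has_value :: "rat \<Rightarrow> ratfun \<Rightarrow> rat \<Rightarrow> bool" where
  "rf_has_value c f v \<longleftrightarrow> rf_regular_at c f \<and> rf_eval c f = v"

text \<open>
  Regularity and value are defined through the reduced fraction, but any fraction whose
  denominator does not vanish at \<open>c\<close> will do: the reduced denominator divides every
  other one, and cross-multiplication transports the value. This is what makes
  the arithmetic below possible, as sums and products of reduced fractions need not be reduced.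
\<close>

lemma rf_has_value_Fract:
  assumes "poly q c \<noteq> 0"
  shows "rf_has_value c (Fract p q) (poly p c / poly q c)"
proof -
  define a b where "a = fst (quot_of_fract (Fract p q))" and "b = snd (quot_of_fract (Fract p q))"
  have ab: "b \<noteq> 0" "coprime a b"
    by (simp_all add: a_def b_def coprime_quot_of_fract)
  have "q \<noteq> 0"
    using assms by auto
  have "Fract a b = Fract p q"
    by (simp add: a_def b_def)
  with ab \<open>q \<noteq> 0\<close> have cross: "a * q = p * b"
    by (simp add: eq_fract)
  hence "b dvd a * q"
    by simp
  with ab have "b dvd q"
    by (simp add: coprime_dvd_mult_right_iff coprime_commute)
  hence b: "poly b c \<noteq> 0"
    using assms by (auto elim!: dvdE)
  have "poly a c * poly q c = poly p c * poly b c"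
    using cross by (metis poly_mult)
  hence "poly a c / poly b c = poly p c / poly q c"
    using b assms by (simp add: frac_eq_eq)
  with b show ?thesis
    by (simp add: rf_has_value_def rf_regular_at_def rf_eval_def a_def b_def)
qed

lemma rf_has_valueE:
  assumes "rf_has_value c f v"
  obtains p q where "f = Fract p q" "poly q c \<noteq> 0" "v = poly p c / poly q c"
  using assms that[of "fst (quot_of_fract f)" "snd (quot_of_fract f)"]
  by (simp add: rf_has_value_def rf_regular_at_def rf_eval_def)

lemma rf_has_value_const: "rf_has_value c (rf_const a) a"
  using rf_has_value_Fract[of 1 c "[:a:]"] by (simp add: rf_const_def to_fract_def)

lemma rf_has_value_q: "rf_has_value c rf_q c"
  using rf_has_value_Fract[of 1 c "[:0, 1:]"] by (simp add: rf_q_def to_fract_def)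

lemma rf_has_value_0: "rf_has_value c 0 0"
  using rf_has_value_const[of c 0] by (simp add: rf_const_def)

lemma rf_has_value_1: "rf_has_value c 1 1"
  using rf_has_value_const[of c 1] by (simp add: rf_const_def to_fract_1 flip: one_pCons)

lemma rf_has_value_add:
  assumes "rf_has_value c f v" "rf_has_value c g w"
  shows "rf_has_value c (f + g) (v + w)"
proof -
  obtain p q where f: "f = Fract p q" "poly q c \<noteq> 0" "v = poly p c / poly q c"
    using assms(1) by (rule rf_has_valueE)
  obtain r s where g: "g = Fract r s" "poly s c \<noteq> 0" "w = poly r c / poly s c"
    using assms(2) by (rule rf_has_valueE)
  have "q \<noteq> 0" "s \<noteq> 0"
    using f g by auto
  with f g show ?thesis
    using rf_has_value_Fract[of "q * s" c "p * s + r * q"]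
    by (simp add: add_frac_eq)
qed

lemma rf_has_value_mult:
  assumes "rf_has_value c f v" "rf_has_value c g w"
  shows "rf_has_value c (f * g) (v * w)"
proof -
  obtain p q where f: "f = Fract p q" "poly q c \<noteq> 0" "v = poly p c / poly q c"
    using assms(1) by (rule rf_has_valueE)
  obtain r s where g: "g = Fract r s" "poly s c \<noteq> 0" "w = poly r c / poly s c"
    using assms(2) by (rule rf_has_valueE)
  from f g show ?thesis
    using rf_has_value_Fract[of "q * s" c "p * r"] by simp
qed

lemma rf_has_value_inverse:
  assumes "rf_has_value c f v" "v \<noteq> 0"
  shows "rf_has_value c (inverse f) (inverse v)"
proof -
  obtain p q where f: "f = Fract p q" "poly q c \<noteq> 0" "v = poly p c / poly q c"
    using assms(1) by (rule rf_has_valueE)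
  with assms(2) show ?thesis
    using rf_has_value_Fract[of p c q] by simp
qed

lemma rf_has_value_divide:
  assumes "rf_has_value c f v" "rf_has_value c g w" "w \<noteq> 0"
  shows "rf_has_value c (f / g) (v / w)"
  using rf_has_value_mult[OF assms(1) rf_has_value_inverse[OF assms(2,3)]]
  by (simp add: divide_inverse)

lemma rf_has_value_diff:
  assumes "rf_has_value c f v" "rf_has_value c g w"
  shows "rf_has_value c (f - g) (v - w)"
proof -
  have "rf_has_value c (rf_const (- 1) * g) (- 1 * w)"
    by (intro rf_has_value_mult rf_has_value_const assms)
  moreover have "rf_const (- 1) = to_fract (- 1)"
    by (simp add: rf_const_def one_pCons)
  hence "rf_const (- 1) = - 1"
    by (simp only: to_fract_uminus to_fract_1)
  ultimately show ?thesis
    using rf_has_value_add[OF assms(1), of "- g" "- w"] by simp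
qed

lemma rf_has_value_power: "rf_has_value c f v \<Longrightarrow> rf_has_value c (f ^ n) (v ^ n)"
  by (induction n) (simp_all add: rf_has_value_1 rf_has_value_mult)

lemma rf_has_value_of_nat: "rf_has_value c (of_nat n) (of_nat n)"
  by (induction n) (simp_all add: rf_has_value_0 rf_has_value_1 rf_has_value_add)

lemma rf_has_value_numeral: "rf_has_value c (numeral k) (numeral k)"
  using rf_has_value_of_nat[of c "numeral k"] by simp

lemma rf_has_value_sum:
  "(\<And>i. i \<in> A \<Longrightarrow> rf_has_value c (f i) (v i)) \<Longrightarrow> rf_has_value c (sum f A) (sum v A)"
  by (induction A rule: infinite_finite_induct) (simp_all add: rf_has_value_0 rf_has_value_add)

lemmas rf_has_value_intros =
  rf_has_value_const rf_has_value_q rf_has_value_1 rf_has_value_add rf_has_value_mult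
  rf_has_value_divide rf_has_value_diff rf_has_value_power rf_has_value_of_nat
  rf_has_value_numeral

lemma rf_eval_eqI: "rf_has_value c f v \<Longrightarrow> rf_eval c f = v"
  by (simp add: rf_has_value_def)

lemma rf_one_minus_q_nonzero: "1 - rf_q \<noteq> 0"
proof
  assume "1 - rf_q = 0"
  moreover have "rf_has_value 0 (1 - rf_q) (1 - 0)"
    by (intro rf_has_value_intros)
  ultimately show False
    using rf_eval_eqI[of 0 0 1] rf_eval_eqI[OF rf_has_value_0, of 0] by simp
qed

lemma fun_a_value_at_0:
  assumes "r \<ge> 1"
  shows "rf_has_value 0 (fun_a d r (rf_q ^ r)) (of_nat d * of_nat r / 5)"
proof -
  have z: "rf_has_value 0 (rf_q ^ r) 0"
    using rf_has_value_power[OF rf_has_value_q, of 0 r] assms by (simp add: power_0_left)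
  have "rf_has_value 0 (fun_a d r (rf_q ^ r))
      ((of_nat d * of_nat r / (1 - 0) + of_nat d * 0 / (1 - 0)\<^sup>2) / 5)"
    unfolding fun_a_def by (intro rf_has_value_intros z) simp_all
  thus ?thesis
    by simp
qed

text \<open>
  The two occurrences of \<open>d\<close>, in the first and in the second pole term, cancel at \<open>q = 0\<close>.
\<close>

lemma fun_b_value_at_0:
  assumes "r \<ge> 1"
  shows "rf_has_value 0 (fun_b d r (rf_q ^ r)) ((of_nat d * of_nat r + of_nat r ^ 2) / 5)"
proof -
  have z: "rf_has_value 0 (rf_q ^ r) 0"
    using rf_has_value_power[OF rf_has_value_q, of 0 r] assms by (simp add: power_0_left)
  have "rf_has_value 0 (fun_b d r (rf_q ^ r))
      (((of_nat r * of_nat d + of_nat r ^ 2 - of_nat d) / (1 - 0)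
        + of_nat d / (1 - 0)^2 - (0 + 0^2) / (1 - 0)^3) / 5)"
    unfolding fun_b_def by (intro rf_has_value_intros z) simp_all
  thus ?thesis
    by (simp add: mult.commute)
qed


section \<open>Sums over factorizations and over divisors\<close>

lemma sum_factorizations_eq_sum_divisors:
  fixes n :: nat
  assumes "n \<ge> 1"
  shows "(\<Sum>(d, r) | d \<ge> 1 \<and> r \<ge> 1 \<and> d * r = n. g d r) = (\<Sum>d | d dvd n. g d (n div d))"
  by (rule sum.reindex_bij_witness[of _ "\<lambda>d. (d, n div d)" fst])
     (use assms in \<open>auto elim!: dvdE\<close>)

text \<open>
  The guard \<open>n \<ge> 1\<close> is inside the index set because every \<open>d\<close> divides \<open>0\<close>, whereas no pair
  \<open>d, r \<ge> 1\<close> has product \<open>0\<close>.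
\<close>

lemma double_series_nth:
  "fps_nth (double_series c) n = (\<Sum>d | n \<ge> 1 \<and> d dvd n. c d (n div d))"
proof (cases "n = 0")
  case True
  have no_pairs: "{(d, r). d \<ge> 1 \<and> r \<ge> 1 \<and> d * r = (0::nat)} = {}"
    by auto
  show ?thesis
    unfolding double_series_def fps_nth_Abs_fps True no_pairs by simp
next
  case False
  thus ?thesis
    using sum_factorizations_eq_sum_divisors[of n c] by (simp add: double_series_def)
qed

lemma double_series_a_value_at_0:
  "rf_has_value 0
     (fps_nth (double_series (\<lambda>d r. fun_a d r (rf_q ^ r) * rf_const (GV GW d))) n)
     (of_nat n * GV_twisted GW 0 n / 5)"
proof -
  have "rf_has_value 0
     (fps_nth (double_series (\<lambda>d r. fun_a d r (rf_q ^ r) * rf_const (GV GW d))) n)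
     (\<Sum>d | n \<ge> 1 \<and> d dvd n. of_nat d * of_nat (n div d) / 5 * GV GW d)"
    unfolding double_series_nth
    by (intro rf_has_value_sum rf_has_value_mult rf_has_value_const fun_a_value_at_0)
       (auto elim!: dvdE)
  also have "(\<Sum>d | n \<ge> 1 \<and> d dvd n. of_nat d * of_nat (n div d) / 5 * GV GW d)
      = of_nat n * GV_twisted GW 0 n / 5"
  proof (cases "n = 0")
    case False
    have "of_nat d * of_nat (n div d) = (of_nat n :: rat)" if "d dvd n" for d
      using that by (metis dvd_mult_div_cancel of_nat_mult)
    thus ?thesis
      using False by (simp add: GV_twisted_def sum_distrib_left sum_divide_distrib)
  qed simp
  finally show ?thesis .
qed

text \<open>The second twist is \<open>-2\<close> because \<open>(n / d)^2 = n^2 d^(-2)\<close>.\<close>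

lemma double_series_b_value_at_0:
  "rf_has_value 0
     (fps_nth (double_series (\<lambda>d r. fun_b d r (rf_q ^ r) * rf_const (GV GW d))) n)
     ((of_nat n * GV_twisted GW 0 n + of_nat n ^ 2 * GV_twisted GW (-2) n) / 5)"
proof -
  have "rf_has_value 0
     (fps_nth (double_series (\<lambda>d r. fun_b d r (rf_q ^ r) * rf_const (GV GW d))) n)
     (\<Sum>d | n \<ge> 1 \<and> d dvd n.
        (of_nat d * of_nat (n div d) + of_nat (n div d) ^ 2) / 5 * GV GW d)"
    unfolding double_series_nth
    by (intro rf_has_value_sum rf_has_value_mult rf_has_value_const fun_b_value_at_0)
       (auto elim!: dvdE)
  also have "(\<Sum>d | n \<ge> 1 \<and> d dvd n.
        (of_nat d * of_nat (n div d) + of_nat (n div d) ^ 2) / 5 * GV GW d)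
      = (of_nat n * GV_twisted GW 0 n + of_nat n ^ 2 * GV_twisted GW (-2) n) / 5"
  proof (cases "n = 0")
    case False
    have "(of_nat d * of_nat (n div d) + of_nat (n div d) ^ 2) / 5 * GV GW d =
        (of_nat n * GV GW d + of_nat n ^ 2 * (of_nat d powi (-2) * GV GW d)) / 5"
      if d: "d dvd n" for d
    proof -
      have "of_nat d \<noteq> (0 :: rat)"
        using d False by auto
      moreover have n: "of_nat n = (of_nat d * of_nat (n div d) :: rat)"
        using d by (metis dvd_mult_div_cancel of_nat_mult)
      ultimately show ?thesis
        unfolding n by (simp add: power_int_minus field_simps power2_eq_square)
    qed
    thus ?thesis
      using False
      by (simp add: GV_twisted_def sum_distrib_left sum.distrib flip: sum_divide_distrib)
  qed simp
  finally show ?thesis .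
qed


section \<open>Coordinates in the truncated polynomial ring\<close>

lemma K_scalar_1: "K_scalar 1 = 1"
  by transfer (simp add: trunc_rel_iff one_pCons)

lemma K_scalar_add: "K_scalar (a + b) = K_scalar a + K_scalar b"
  by transfer (simp add: trunc_rel_iff)

lemma K_scalar_numeral: "K_scalar (numeral k) = numeral k"
  by (induction k) (simp_all only: numeral.simps K_scalar_add K_scalar_1)

lemma K_coeff_x_power_mult_scalar:
  "K_coeff (K_x ^ m * K_scalar c) i = (if i = m \<and> i < 4 then c else 0)"
  by (auto simp: K_coeff_x_power_mult K_coeff_scalar)

lemma K_fps_eqI:
  assumes "\<And>n i. i < 4 \<Longrightarrow> K_coeff (fps_nth F n) i = K_coeff (fps_nth G n) i"
  shows "F = G"
  using assms by (intro fps_ext K_eqI)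

lemma K_coeff_of_normalized_series:
  assumes "fps_const (K_scalar (1 / (1 - rf_q))) * J =
      1 + fps_const (K_x^2) * K_series A + fps_const (K_x^3) * K_series B"
  shows "K_coeff (fps_nth J n) i = (1 - rf_q) *
     ((if n = 0 \<and> i = 0 then 1 else 0) + (if i = 2 then fps_nth A n else 0)
        + (if i = 3 then fps_nth B n else 0))"
proof -
  have "K_coeff (fps_nth (fps_const (K_scalar (1 / (1 - rf_q))) * J) n) i =
      (if n = 0 \<and> i = 0 then 1 else 0) + (if i = 2 then fps_nth A n else 0)
        + (if i = 3 then fps_nth B n else 0)"
    unfolding assms
    by (auto simp: K_series_def K_coeff_x_power_mult_scalar K_coeff_scalar simp flip: K_scalar_1)
  moreover have "K_coeff (fps_nth (fps_const (K_scalar (1 / (1 - rf_q))) * J) n) i =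
      1 / (1 - rf_q) * K_coeff (fps_nth J n) i"
    by (simp only: fps_mult_left_const_nth K_coeff_scalar_mult)
  ultimately show ?thesis
    using rf_one_minus_q_nonzero
    by (metis mult.left_commute mult_1_right nonzero_mult_div_cancel_left
          times_divide_eq_left times_divide_eq_right)
qed


section \<open>The first four coefficients and the value of \<open>J\<close>\<close>

lemma fps_eq_prefix_4:
  fixes F :: "'a::comm_ring_1 fps"
  assumes "fps_nth F 0 = 0"
  shows "F = fps_const (fps_nth F 1) * fps_X + fps_const (fps_nth F 2) * fps_X^2
     + fps_const (fps_nth F 3) * fps_X^3 + fps_const (fps_nth F 4) * fps_X^4
     + fps_X^5 * fps_shift 5 F"
proof (rule fps_ext)
  fix n :: nat
  consider "n = 0" | "n = 1" | "n = 2" | "n = 3" | "n = 4" | "n \<ge> 5"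
    by linarith
  thus "fps_nth F n = fps_nth (fps_const (fps_nth F 1) * fps_X + fps_const (fps_nth F 2) * fps_X^2
     + fps_const (fps_nth F 3) * fps_X^3 + fps_const (fps_nth F 4) * fps_X^4
     + fps_X^5 * fps_shift 5 F) n"
    by cases (simp_all add: assms fps_X_power_mult_nth)
qed

lemma GV_twisted_small:
  "GV_twisted GW \<gamma> 1 = GV GW 1"
  "GV_twisted GW \<gamma> 2 = GV GW 1 + 2 powi \<gamma> * GV GW 2"
  "GV_twisted GW \<gamma> 3 = GV GW 1 + 3 powi \<gamma> * GV GW 3"
  "GV_twisted GW \<gamma> 4 = GV GW 1 + 2 powi \<gamma> * GV GW 2 + 4 powi \<gamma> * GV GW 4"
proof -
  have divisors: "{d. d dvd n} = {d. (d = 0 \<or> d = 1 \<or> d = 2 \<or> d = 3 \<or> d = 4) \<and> d dvd n}"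
    if "n > 0" "n \<le> 4" for n :: nat
  proof -
    have "d = 0 \<or> d = 1 \<or> d = 2 \<or> d = 3 \<or> d = 4" if "d dvd n" for d
      using dvd_imp_le[OF that \<open>n > 0\<close>] \<open>n \<le> 4\<close> by linarith
    thus ?thesis
      by blast
  qed
  have "{d. d dvd 1} = {1::nat}" "{d. d dvd 2} = {1, 2::nat}" "{d. d dvd 3} = {1, 3::nat}"
    "{d. d dvd 4} = {1, 2, 4::nat}"
    by (subst divisors; auto)+
  thus "GV_twisted GW \<gamma> 1 = GV GW 1"
    "GV_twisted GW \<gamma> 2 = GV GW 1 + 2 powi \<gamma> * GV GW 2"
    "GV_twisted GW \<gamma> 3 = GV GW 1 + 3 powi \<gamma> * GV GW 3"
    "GV_twisted GW \<gamma> 4 = GV GW 1 + 2 powi \<gamma> * GV GW 2 + 4 powi \<gamma> * GV GW 4"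
    by (simp_all only: GV_twisted_def) simp_all
qed

theorem corollary1p2:
  fixes ev :: "rat quintic_K \<Rightarrow> 'm::comm_ring_1"
    and L :: 'm
    and chi_vir :: "nat \<Rightarrow> 'm \<Rightarrow> rat"
    and GW :: "nat \<Rightarrow> rat"
  assumes "stable_maps_K_theory ev L chi_vir"
    and "GV GW 1 = 2875" and "GV GW 2 = 609250"
    and "GV GW 3 = 317206375" and "GV GW 4 = 242467530000"
    and "fps_const (K_scalar (1 / (1 - rf_q))) * small_J ev L chi_vir =
      1 + fps_const (K_x^2) *
            K_series (double_series (\<lambda>d r. fun_a d r (rf_q ^ r) * rf_const (GV GW d)))
        + fps_const (K_x^3) *
            K_series (double_series (\<lambda>d r. fun_b d r (rf_q ^ r) * rf_const (GV GW d)))"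
  shows
    "5 * small_J_at_0 ev L chi_vir =
      5 + fps_const (K_x^2) *
            K_series (Abs_fps (\<lambda>n. of_nat n * GV_twisted GW 0 n))
        + fps_const (K_x^3) *
            K_series (Abs_fps (\<lambda>n. of_nat n * GV_twisted GW 0 n + of_nat n ^ 2 * GV_twisted GW (-2) n))
     \<and> (\<exists>R2 R3.
      5 * small_J_at_0 ev L chi_vir =
      5 + K_series (2875 * fps_X + 1224250 * fps_X^2 + 951627750 * fps_X^3
                    + 969872568500 * fps_X^4 + fps_X^5 * R2) * fps_const (K_x^2)
        + K_series (5750 * fps_X + 1845000 * fps_X^2 + 1268860000 * fps_X^3
                    + 1212342581500 * fps_X^4 + fps_X^5 * R3) * fps_const (K_x^3))"
proof -
  define A where "A = double_series (\<lambda>d r. fun_a d r (rf_q ^ r) * rf_const (GV GW d))"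
  define B where "B = double_series (\<lambda>d r. fun_b d r (rf_q ^ r) * rf_const (GV GW d))"
  define F where "F = Abs_fps (\<lambda>n. of_nat n * GV_twisted GW 0 n)"
  define G where
    "G = Abs_fps (\<lambda>n. of_nat n * GV_twisted GW 0 n + of_nat n ^ 2 * GV_twisted GW (-2) n)"
  have coeff_J: "K_coeff (fps_nth (small_J ev L chi_vir) n) i = (1 - rf_q) *
     ((if n = 0 \<and> i = 0 then 1 else 0) + (if i = 2 then fps_nth A n else 0)
        + (if i = 3 then fps_nth B n else 0))" for n i
    using assms(6) unfolding A_def B_def by (rule K_coeff_of_normalized_series)
  \<comment> \<open>The factor \<open>1 - 0\<close> is the value of \<open>1 - q\<close>; unreduced, the statement follows the shape of
    \<open>coeff_J\<close>, so that the closure rules apply structurally.\<close>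
  have value_J: "rf_has_value 0 (K_coeff (fps_nth (small_J ev L chi_vir) n) i)
     ((1 - 0) * ((if n = 0 \<and> i = 0 then 1 else 0) + (if i = 2 then fps_nth F n / 5 else 0)
        + (if i = 3 then fps_nth G n / 5 else 0)))" for n i
    unfolding coeff_J
    by (intro rf_has_value_intros)
       (auto simp: A_def B_def F_def G_def rf_has_value_0 rf_has_value_1
          double_series_a_value_at_0 double_series_b_value_at_0)
  have closed: "5 * small_J_at_0 ev L chi_vir =
      5 + fps_const (K_x^2) * K_series F + fps_const (K_x^3) * K_series G"
  proof (rule K_fps_eqI)
    fix n i :: nat
    assume i: "i < 4"
    have "5 * small_J_at_0 ev L chi_vir = fps_const (K_scalar 5) * small_J_at_0 ev L chi_vir"
      and five: "(5 :: rat quintic_K fps) = fps_const (K_scalar 5)"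
      by (simp_all add: K_scalar_numeral numeral_fps_const)
    thus "K_coeff (fps_nth (5 * small_J_at_0 ev L chi_vir) n) i =
        K_coeff (fps_nth (5 + fps_const (K_x^2) * K_series F + fps_const (K_x^3) * K_series G) n) i"
      using i rf_eval_eqI[OF value_J[of n i]] unfolding five
      by (auto simp: small_J_at_0_def K_coeff_map K_series_def K_coeff_x_power_mult_scalar
            K_coeff_scalar)
  qed
  have "fps_nth F 0 = 0" "fps_nth G 0 = 0"
    by (simp_all add: F_def G_def)
  note prefixes = this[THEN fps_eq_prefix_4]
  have coeffs: "fps_nth F 1 = 2875" "fps_nth F 2 = 1224250" "fps_nth F 3 = 951627750"
      "fps_nth F 4 = 969872568500"
      "fps_nth G 1 = 5750" "fps_nth G 2 = 1845000" "fps_nth G 3 = 1268860000"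
      "fps_nth G 4 = 1212342581500"
    unfolding F_def G_def fps_nth_Abs_fps GV_twisted_small assms(2-5)
    by (simp_all add: power_int_minus)
  have "\<exists>R2 R3. 5 * small_J_at_0 ev L chi_vir =
      5 + K_series (2875 * fps_X + 1224250 * fps_X^2 + 951627750 * fps_X^3
                    + 969872568500 * fps_X^4 + fps_X^5 * R2) * fps_const (K_x^2)
        + K_series (5750 * fps_X + 1845000 * fps_X^2 + 1268860000 * fps_X^3
                    + 1212342581500 * fps_X^4 + fps_X^5 * R3) * fps_const (K_x^3)"
    using closed prefixes unfolding coeffs
    by (intro exI[of _ "fps_shift 5 F"] exI[of _ "fps_shift 5 G"])
       (simp only: numeral_fps_const mult.commute[of "K_series _"])
  with closed show ?thesis
    unfolding F_def G_def by blast
qed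

end
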